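(* Let $X\subseteq \mathbb{R}$ be a set that is arbitrarily relatively fine. Then $X$ is non-universal (modulo similarities) with respect to the sets with complement of finite Lebesgue measure. Moreover, for every $\varepsilon >0$ there exists an open set $G\subseteq \mathbb{R}$ with $\lambda (G)<\varepsilon$ such that any similar copy of $X$ intersects $G$ in an infinite set; in other words, the set $\mathbb{R} \setminus G$ does not contain any similar copy of $X \setminus K$, for any finite set $K$.
   Context: $\lambda$ denotes (outer) Lebesgue measure on $\mathbb{R}$. A similar copy of a set $X\subseteq\mathbb{R}$ is a set of the form $a+bX=\{a+bx: x\in X\}$ with $a\in\mathbb{R}$ and $b\in\mathbb{R}\setminus\{0\}$. A set $X\subseteq\mathbb{R}$ is non-universal (modulo similarities) with respect to the sets with complement of finite Lebesgue measure if there is a Lebesgue measurable set $C\subseteq\mathbb{R}$ with $\lambda(\mathbb{R}\setminus C)<\infty$ that contains no similar copy of $X$. A set $X\subseteq\mathbb{R}$ is called arbitrarily relatively fine if for every $\varepsilon>0$ there exist $k\ge 2$ and elements $y_1>y_2>\dots>y_k$ of $X$ such that $$(1+|y_1|+|y_k|)(y_i-y_{i+1})\leq \varepsilon\,(y_1-y_k)\quad\text{for every } i=1,2,\dots,k-1.$$ *)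

theory Defs
  imports "HOL-Analysis.Analysis"
begin

definition similar_copy :: "real set \<Rightarrow> real set \<Rightarrow> bool" where
  "similar_copy Y X \<longleftrightarrow> (\<exists>a b. b \<noteq> 0 \<and> Y = (\<lambda>x. a + b * x) ` X)"

definition nonuniversal_cofinite_measure :: "real set \<Rightarrow> bool" where
  "nonuniversal_cofinite_measure X \<longleftrightarrow>
     (\<exists>C. C \<in> sets lebesgue \<and> emeasure lebesgue (- C) < \<infinity> \<and>
          \<not> (\<exists>Y. similar_copy Y X \<and> Y \<subseteq> C))"

(* The points are indexed from 1 to k; values of y outside {1..k} are irrelevant. *)
definition arbitrarily_relatively_fine :: "real set \<Rightarrow> bool" where
  "arbitrarily_relatively_fine X \<longleftrightarrow>
     (\<forall>\<epsilon>::real. \<epsilon> > 0 \<longrightarrow>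
       (\<exists>(k::nat) (y::nat \<Rightarrow> real). k \<ge> 2 \<and>
          (\<forall>i\<in>{1..k}. y i \<in> X) \<and>
          (\<forall>i\<in>{1..<k}. y i > y (i + 1)) \<and>
          (\<forall>i\<in>{1..<k}. (1 + \<bar>y 1\<bar> + \<bar>y k\<bar>) * (y i - y (i + 1)) \<le> \<epsilon> * (y 1 - y k))))"

end

theory Submission
  imports Defs
begin

text \<open>Take finitely many points of \<open>X\<close> with span \<open>D\<close> and gaps at most \<open>\<epsilon> D / (1 + M)\<close>, where
  \<open>M\<close> is the sum of the absolute values of the extreme points. For \<open>\<bar>a\<bar> \<le> n\<close> and
  \<open>1 / n \<le> \<bar>b\<bar> \<le> n\<close> their image under \<open>x \<mapsto> a + b x\<close> lies within distance \<open>n (1 + M)\<close> of the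
  origin, has span at least \<open>D / n\<close> and gaps at most \<open>n \<epsilon> D / (1 + M)\<close>. Intervals of length
  \<open>2 n\<^sup>2 \<epsilon> D / (1 + M)\<close>, repeated with period \<open>D / (2 n)\<close> over this range, therefore catch at least
  \<open>n\<close> points of the image, and their total length is of order \<open>n\<^sup>4 \<epsilon>\<close>, independently of \<open>D\<close> and
  \<open>M\<close>. The union over \<open>n\<close> of such sets, with \<open>\<epsilon>\<close> chosen small in terms of \<open>n\<close>, is the set \<open>G\<close>.\<close>

section \<open>Values of finite sequences with small gaps\<close>

lemma ex_point_in_window_decreasing:
  fixes z :: "nat \<Rightarrow> real"
  assumes "1 \<le> k" and gap: "\<And>i. i \<in> {1..<k} \<Longrightarrow> z i - z (i + 1) < h"
    and "z k \<le> c" "c < z 1"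
  shows "\<exists>i\<in>{1..k}. c < z i \<and> z i < c + h"
proof -
  \<comment> \<open>The last index \<open>m\<close> with \<open>c < z m\<close> works. It differs
    from \<open>k\<close>, so the next value is at most \<open>c\<close>, and the gap bound puts
    \<open>z m\<close> below \<open>c + h\<close>.\<close>
  define S where "S = {i \<in> {1..k}. c < z i}"
  define m where "m = Max S"
  have S: "finite S" "S \<noteq> {}"
    using assms by (auto simp: S_def)
  have mS: "m \<in> S"
    unfolding m_def using S by (rule Max_in)
  moreover have "m \<noteq> k"
    using mS \<open>z k \<le> c\<close> by (auto simp: S_def)
  ultimately have m: "m \<in> {1..<k}" "c < z m"
    by (auto simp: S_def)
  have "m + 1 \<notin> S"
    using Max_ge[OF S(1), of "m + 1"] by (auto simp: m_def)
  with m have "z (m + 1) \<le> c"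
    by (auto simp: S_def)
  with gap[OF m(1)] m show ?thesis
    by (intro bexI[of _ m]) auto
qed

text \<open>A negative scaling factor reverses the order of the points, hence the symmetric form in
  \<open>min\<close> and \<open>max\<close>. If \<open>z 1 < z k\<close>, the reflection
  \<open>- z\<close> and the window starting at \<open>- (c + h)\<close> reduce to the decreasing
  case.\<close>

lemma ex_point_in_window:
  fixes z :: "nat \<Rightarrow> real"
  assumes "1 \<le> k" and gap: "\<And>i. i \<in> {1..<k} \<Longrightarrow> \<bar>z i - z (i + 1)\<bar> < h"
    and "0 < h" "min (z 1) (z k) \<le> c" "c + h \<le> max (z 1) (z k)"
  shows "\<exists>i\<in>{1..k}. c < z i \<and> z i < c + h"
proof (cases "z k \<le> z 1")
  case True
  with assms show ?thesis
    by (intro ex_point_in_window_decreasing) (auto simp: abs_less_iff)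
next
  case False
  have "\<exists>i\<in>{1..k}. - (c + h) < - z i \<and> - z i < - (c + h) + h"
    using assms False
    by (intro ex_point_in_window_decreasing) (force simp: abs_less_iff)+
  then show ?thesis
    by force
qed

text \<open>The window splits into \<open>n\<close> consecutive open intervals of length
  \<open>h\<close>. Each contains a value of \<open>z\<close>, and values from different intervals
  are distinct.\<close>

lemma card_points_in_window:
  fixes z :: "nat \<Rightarrow> real"
  assumes "1 \<le> k" and gap: "\<And>i. i \<in> {1..<k} \<Longrightarrow> \<bar>z i - z (i + 1)\<bar> < h"
    and "0 < h" "min (z 1) (z k) \<le> c" "c + real n * h \<le> max (z 1) (z k)"
  shows "n \<le> card (z ` {1..k} \<inter> {c<..<c + real n * h})"
proof -
  let ?I = "\<lambda>m. {c + real m * h<..<c + real (Suc m) * h}"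
  have step: "real (Suc m) * h \<le> real m' * h" if "m < m'" for m m'
    using that \<open>0 < h\<close> by (intro mult_right_mono) auto
  have "\<exists>x. x \<in> z ` {1..k} \<inter> ?I m" if "m < n" for m
  proof -
    have "0 \<le> real m * h"
      using \<open>0 < h\<close> by simp
    then have "min (z 1) (z k) \<le> c + real m * h"
      using assms(4) by linarith
    moreover have "c + real m * h + h \<le> c + real n * h"
      using step[OF that] by (simp add: algebra_simps)
    then have "c + real m * h + h \<le> max (z 1) (z k)"
      using assms(5) by linarith
    ultimately have "\<exists>i\<in>{1..k}. c + real m * h < z i \<and> z i < c + real m * h + h"
      using assms(1-3) by (intro ex_point_in_window) auto
    then show ?thesis
      by (auto simp: algebra_simps)
  qed
  then obtain f where f: "\<And>m. m < n \<Longrightarrow> f m \<in> z ` {1..k} \<inter> ?I m"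
    by metis
  have less: "f m < f m'" if "m < m'" "m' < n" for m m'
    using f[of m] f[of m'] step[OF that(1)] that by auto
  have "inj_on f {..<n}"
    by (rule linorder_inj_onI) (use less in force)+
  moreover have "f ` {..<n} \<subseteq> z ` {1..k} \<inter> {c<..<c + real n * h}"
  proof (intro image_subsetI)
    fix m assume "m \<in> {..<n}"
    then have "m < n"
      by simp
    moreover have "0 \<le> real m * h"
      using \<open>0 < h\<close> by simp
    ultimately show "f m \<in> z ` {1..k} \<inter> {c<..<c + real n * h}"
      using f[of m] step[of m n] by (auto simp del: of_nat_Suc)
  qed
  ultimately show ?thesis
    by (metis card_image card_lessThan card_mono finite_Int finite_atLeastAtMost finite_imageI)
qed

section \<open>The open set for a single scale\<close>

lemma emeasure_UN_periodic_intervals_le: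
  fixes P L :: real and J :: int
  assumes "0 \<le> L" "0 \<le> J"
  shows "emeasure lebesgue (\<Union>j\<in>{-J..J}. {real_of_int j * P<..<real_of_int j * P + L})
    \<le> ennreal ((2 * real_of_int J + 1) * L)"
proof -
  have "emeasure lebesgue (\<Union>j\<in>{-J..J}. {real_of_int j * P<..<real_of_int j * P + L})
    \<le> (\<Sum>j\<in>{-J..J}. emeasure lebesgue {real_of_int j * P<..<real_of_int j * P + L})"
    by (intro emeasure_subadditive_finite) auto
  also have "\<dots> = (\<Sum>j\<in>{-J..J}. ennreal L)"
    using assms by (intro sum.cong) auto
  also have "\<dots> = ennreal (real (card {-J..J}) * L)"
    using assms by (simp add: ennreal_mult ennreal_of_nat_eq_real_of_nat)
  also have "real (card {-J..J}) = 2 * real_of_int J + 1"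
    using assms by simp
  finally show ?thesis .
qed

text \<open>The intersection may be infinite, and \<open>card\<close> is then 0. A finite subset
  \<open>S\<close> therefore expresses that there are at least \<open>n\<close> points.\<close>

lemma ex_open_card_ge:
  fixes X :: "real set"
  assumes X: "arbitrarily_relatively_fine X" and n: "1 \<le> n" and "0 < \<delta>"
  shows "\<exists>G. open G \<and> emeasure lebesgue G \<le> ennreal \<delta> \<and>
    (\<forall>a b. \<bar>a\<bar> \<le> real n \<longrightarrow> 1 / real n \<le> \<bar>b\<bar> \<longrightarrow> \<bar>b\<bar> \<le> real n \<longrightarrow>
      (\<exists>S \<subseteq> (\<lambda>x. a + b * x) ` X \<inter> G. finite S \<and> n \<le> card S))"
proof -
  define N where "N = real n"
  have N: "1 \<le> N"
    using n by (simp add: N_def)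
  \<comment> \<open>The first bound makes an interval of length \<open>N * h\<close> fit into one
    period \<open>P\<close>, the second keeps the total length below
    \<open>\<delta>\<close>.\<close>
  define e where "e = min (1 / (4 * N ^ 3)) (\<delta> / (18 * N ^ 4))"
  have e: "0 < e" "4 * N ^ 3 * e \<le> 1" "18 * N ^ 4 * e \<le> \<delta>"
  proof -
    show "0 < e"
      using N \<open>0 < \<delta>\<close> by (simp add: e_def)
    have "e \<le> 1 / (4 * N ^ 3)" "e \<le> \<delta> / (18 * N ^ 4)"
      by (auto simp: e_def)
    then show "4 * N ^ 3 * e \<le> 1" "18 * N ^ 4 * e \<le> \<delta>"
      using N by (auto simp: field_simps)
  qed
  obtain k :: nat and y :: "nat \<Rightarrow> real" where "k \<ge> 2 \<and> (\<forall>i\<in>{1..k}. y i \<in> X) \<and>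
      (\<forall>i\<in>{1..<k}. y i > y (i + 1)) \<and>
      (\<forall>i\<in>{1..<k}. (1 + \<bar>y 1\<bar> + \<bar>y k\<bar>) * (y i - y (i + 1)) \<le> e * (y 1 - y k))"
    using mp[OF spec[OF X[unfolded arbitrarily_relatively_fine_def], of e] e(1)]
    by (elim exE) (rule that, assumption)
  then have k: "k \<ge> 2" and yX: "\<And>i. i \<in> {1..k} \<Longrightarrow> y i \<in> X"
    and dec: "\<And>i. i \<in> {1..<k} \<Longrightarrow> y i > y (i + 1)"
    and fine: "\<And>i. i \<in> {1..<k} \<Longrightarrow>
      (1 + \<bar>y 1\<bar> + \<bar>y k\<bar>) * (y i - y (i + 1)) \<le> e * (y 1 - y k)"
    by blast+
  define D where "D = y 1 - y k"
  \<comment> \<open>Unlike in the overview, \<open>M\<close> includes the summand 1, which gives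
    both \<open>1 \<le> M\<close> and \<open>D \<le> M\<close>.\<close>
  define M where "M = 1 + \<bar>y 1\<bar> + \<bar>y k\<bar>"
  define g where "g = e * D / M"
  \<comment> \<open>The factor 2 makes the gaps of the image, which are at most
    \<open>N * g\<close>, strictly smaller than \<open>h\<close>.\<close>
  define h where "h = 2 * N * g"
  define P where "P = D / (2 * N)"
  define T where "T = N\<^sup>2 * (M / D)"
  define J where "J = \<lfloor>4 * T\<rfloor>"
  define G where "G = (\<Union>j\<in>{-J..J}. {real_of_int j * P<..<real_of_int j * P + N * h})"
  have M: "1 \<le> M" "D \<le> M"
    by (auto simp: M_def D_def)
  have D: "0 < D"
  proof -
    have "0 < M * (y 1 - y (1 + 1))"
      using dec[of 1] k M by simp
    also have "\<dots> \<le> e * D"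
      using fine[of 1] k by (simp add: M_def D_def)
    finally show ?thesis
      using e(1) by (simp add: zero_less_mult_iff)
  qed
  have g: "0 < g" "\<And>i. i \<in> {1..<k} \<Longrightarrow> y i - y (i + 1) \<le> g"
    using e D M fine by (auto simp: g_def M_def D_def pos_le_divide_eq mult.commute)
  have h: "0 < h"
    using g N by (simp add: h_def)
  have P: "0 < P"
    using D N by (simp add: P_def)
  have Nh: "N * h = 2 * N\<^sup>2 * e * D / M"
    by (simp add: h_def g_def power2_eq_square)
  have Nh_le: "N * h \<le> P"
  proof -
    have "(4 * N ^ 3 * e) * D \<le> M * D"
      using e(2) D M(1) by (intro mult_right_mono) auto
    then show ?thesis
      unfolding Nh P_def using N M
      by (simp add: divide_simps) (simp add: algebra_simps power2_eq_square power3_eq_cube)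
  qed
  have "0 \<le> J"
    using M D by (simp add: J_def T_def)
  have "emeasure lebesgue G \<le> ennreal ((2 * real_of_int J + 1) * (N * h))"
    unfolding G_def using N h \<open>0 \<le> J\<close> by (intro emeasure_UN_periodic_intervals_le) auto
  also have "\<dots> \<le> ennreal \<delta>"
  proof (rule ennreal_leI)
    \<comment> \<open>Since \<open>T\<close> is at least 1, the summand 1 in
      \<open>2 * J + 1\<close> is absorbed into \<open>9 * T\<close>. The factor
      \<open>M / D\<close> in \<open>T\<close> then cancels \<open>D / M\<close> in
      \<open>N * h\<close>.\<close>
    have "1 * 1 \<le> T"
      unfolding T_def using N M D by (intro mult_mono) (auto simp: one_le_power)
    moreover have "real_of_int J \<le> 4 * T"
      unfolding J_def by (rule of_int_floor_le)
    ultimately have "2 * real_of_int J + 1 \<le> 9 * T"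
      by linarith
    then have "(2 * real_of_int J + 1) * (N * h) \<le> 9 * T * (N * h)"
      using N h by (intro mult_right_mono) auto
    also have "\<dots> = 18 * N ^ 4 * e"
      unfolding Nh T_def using D M by (simp add: field_simps power2_eq_square power4_eq_xxxx)
    finally show "(2 * real_of_int J + 1) * (N * h) \<le> \<delta>"
      using e(3) by linarith
  qed
  finally have "emeasure lebesgue G \<le> ennreal \<delta>" .
  moreover have "open G"
    by (auto simp: G_def)
  moreover have "\<exists>S \<subseteq> (\<lambda>x. a + b * x) ` X \<inter> G. finite S \<and> n \<le> card S"
    if a: "\<bar>a\<bar> \<le> real n" and b: "1 / real n \<le> \<bar>b\<bar>" "\<bar>b\<bar> \<le> real n" for a b
  proof -
    define z where "z = (\<lambda>i. a + b * y i)"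
    define lo where "lo = min (z 1) (z k)"
    \<comment> \<open>The first grid point \<open>j * P\<close> at or above \<open>lo\<close> is
      less than \<open>lo + P\<close>. A window of length \<open>N * h \<le> P\<close> starting
      there ends before \<open>lo + 2 * P\<close>, and the image reaches that far because its span
      is at least \<open>D / N = 2 * P\<close>.\<close>
    define j where "j = \<lceil>lo / P\<rceil>"
    have z_gap: "\<bar>z i - z (i + 1)\<bar> < h" if i: "i \<in> {1..<k}" for i
    proof -
      have "\<bar>z i - z (i + 1)\<bar> = \<bar>b\<bar> * \<bar>y i - y (i + 1)\<bar>"
        by (simp add: z_def abs_mult[symmetric] algebra_simps)
      also have "\<dots> \<le> N * g"
        using b g(2)[OF i] dec[OF i] N by (intro mult_mono) (auto simp: N_def)
      also have "\<dots> < h"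
        using N g by (simp add: h_def)
      finally show ?thesis .
    qed
    have span: "lo + 2 * P \<le> max (z 1) (z k)"
    proof -
      have "2 * P = 1 / N * D"
        by (simp add: P_def)
      also have "\<dots> \<le> \<bar>b\<bar> * D"
        using b D by (intro mult_right_mono) (auto simp: N_def)
      also have "\<dots> = \<bar>z 1 - z k\<bar>"
        using D by (simp add: z_def D_def abs_mult right_diff_distrib[symmetric])
      finally show ?thesis
        by (auto simp: lo_def)
    qed
    have "lo / P \<le> real_of_int j" "real_of_int j < lo / P + 1"
      unfolding j_def by linarith+
    then have j: "lo \<le> real_of_int j * P" "real_of_int j * P < lo + P"
      using P by (simp_all add: field_simps)
    \<comment> \<open>Both \<open>\<bar>lo\<bar>\<close> and \<open>P\<close> are at most
      \<open>N * M\<close>, so \<open>\<bar>j * P\<bar>\<close> is at most \<open>2 * N * M\<close>,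
      which is \<open>4 * T * P\<close>.\<close>
    have "j \<in> {-J..J}"
    proof -
      have "\<bar>z i\<bar> \<le> N * M" if "i = 1 \<or> i = k" for i
      proof -
        have "\<bar>z i\<bar> \<le> \<bar>a\<bar> + \<bar>b\<bar> * \<bar>y i\<bar>"
          unfolding z_def by (metis abs_mult abs_triangle_ineq)
        also have "\<dots> \<le> N + N * (\<bar>y 1\<bar> + \<bar>y k\<bar>)"
          using a b that by (intro add_mono mult_mono) (auto simp: N_def)
        finally show ?thesis
          by (simp add: M_def algebra_simps)
      qed
      then have "\<bar>lo\<bar> \<le> N * M"
        by (auto simp: lo_def min_def)
      moreover have "P \<le> N * M"
      proof -
        have "P \<le> 1 * D"
          unfolding P_def using N D by (simp add: field_simps)
        also have "\<dots> \<le> N * M"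
          using N M D by (intro mult_mono) auto
        finally show ?thesis .
      qed
      ultimately have "\<bar>real_of_int j * P\<bar> \<le> 2 * (N * M)"
        using j by linarith
      then have "\<bar>real_of_int j\<bar> \<le> 2 * (N * M) / P"
        using P by (simp add: abs_mult pos_le_divide_eq)
      also have "\<dots> = 4 * T"
        using N D by (simp add: P_def T_def field_simps power2_eq_square)
      finally have "\<bar>j\<bar> \<le> J"
        unfolding J_def by linarith
      then show ?thesis
        by auto
    qed
    then have "{real_of_int j * P<..<real_of_int j * P + real n * h} \<subseteq> G"
      by (auto simp: G_def N_def)
    moreover have "z ` {1..k} \<subseteq> (\<lambda>x. a + b * x) ` X"
      using yX by (auto simp: z_def)
    moreover have "n \<le> card (z ` {1..k} \<inter> {real_of_int j * P<..<real_of_int j * P + real n * h})"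
      using k z_gap h j Nh_le span
      by (intro card_points_in_window) (auto simp: lo_def N_def)
    ultimately show ?thesis
      by (intro exI[of _ "z ` {1..k} \<inter> {real_of_int j * P<..<real_of_int j * P + real n * h}"])
        auto
  qed
  ultimately show ?thesis
    by blast
qed

section \<open>Union over all scales\<close>

lemma ex_open_infinite_Int:
  fixes X :: "real set"
  assumes X: "arbitrarily_relatively_fine X" and "0 < \<epsilon>"
  shows "\<exists>G. open G \<and> emeasure lebesgue G < ennreal \<epsilon> \<and>
    (\<forall>Y. similar_copy Y X \<longrightarrow> infinite (Y \<inter> G))"
proof -
  \<comment> \<open>These bounds sum to \<open>\<epsilon> / 2\<close>, which leaves room for the
    strict inequality.\<close>
  define \<delta> where "\<delta> = (\<lambda>m. \<epsilon> / 2 * (1 / 2) ^ Suc m)"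
  have "\<forall>m. \<exists>G. open G \<and> emeasure lebesgue G \<le> ennreal (\<delta> m) \<and>
    (\<forall>a b. \<bar>a\<bar> \<le> real (Suc m) \<longrightarrow> 1 / real (Suc m) \<le> \<bar>b\<bar> \<longrightarrow> \<bar>b\<bar> \<le> real (Suc m) \<longrightarrow>
      (\<exists>S \<subseteq> (\<lambda>x. a + b * x) ` X \<inter> G. finite S \<and> Suc m \<le> card S))"
    using \<open>0 < \<epsilon>\<close> by (intro allI ex_open_card_ge[OF X]) (auto simp: \<delta>_def)
  then obtain G where G: "\<And>m. open (G m)" "\<And>m. emeasure lebesgue (G m) \<le> ennreal (\<delta> m)"
    "\<And>m a b. \<bar>a\<bar> \<le> real (Suc m) \<Longrightarrow> 1 / real (Suc m) \<le> \<bar>b\<bar> \<Longrightarrow> \<bar>b\<bar> \<le> real (Suc m) \<Longrightarrow>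
      \<exists>S \<subseteq> (\<lambda>x. a + b * x) ` X \<inter> G m. finite S \<and> Suc m \<le> card S"
    by metis
  have "\<delta> sums (\<epsilon> / 2 * 1)"
    unfolding \<delta>_def by (intro sums_mult power_half_series)
  then have \<delta>: "(\<lambda>m. ennreal (\<delta> m)) sums ennreal (\<epsilon> / 2)"
    using \<open>0 < \<epsilon>\<close> by (subst sums_ennreal) (auto simp: \<delta>_def)
  have "emeasure lebesgue (\<Union>m. G m) \<le> (\<Sum>m. emeasure lebesgue (G m))"
    using G(1) by (intro emeasure_subadditive_countably) auto
  also have "\<dots> \<le> (\<Sum>m. ennreal (\<delta> m))"
    using G(2) by (intro suminf_le) auto
  also have "\<dots> = ennreal (\<epsilon> / 2)"
    using \<delta> by (simp add: sums_iff)
  also have "\<dots> < ennreal \<epsilon>"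
    using \<open>0 < \<epsilon>\<close> by (simp add: ennreal_less_iff)
  finally have "emeasure lebesgue (\<Union>m. G m) < ennreal \<epsilon>" .
  moreover have "infinite (Y \<inter> (\<Union>m. G m))" if "similar_copy Y X" for Y
  proof
    assume fin: "finite (Y \<inter> (\<Union>m. G m))"
    from that obtain a b where "b \<noteq> 0" and Y: "Y = (\<lambda>x. a + b * x) ` X"
      by (auto simp: similar_copy_def)
    \<comment> \<open>Every pair \<open>a\<close>, \<open>b\<close> with \<open>b \<noteq> 0\<close>
      is admissible at all large scales. Choosing \<open>m\<close> also at least the supposed finite
      cardinality gives a contradiction, as \<open>G m\<close> already contains \<open>Suc m\<close>
      points of \<open>Y\<close>.\<close>
    obtain m where m: "max (max \<bar>a\<bar> \<bar>b\<bar>) (max (1 / \<bar>b\<bar>) (card (Y \<inter> (\<Union>m. G m)))) \<le> real m"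
      using real_arch_simple by blast
    then have "1 / \<bar>b\<bar> \<le> real (Suc m)"
      by auto
    then have "1 / real (Suc m) \<le> \<bar>b\<bar>"
      using \<open>b \<noteq> 0\<close> by (simp add: field_simps)
    with m obtain S where "S \<subseteq> Y \<inter> G m" "Suc m \<le> card S"
      using G(3)[of a m b] unfolding Y by auto
    moreover from this have "card S \<le> card (Y \<inter> (\<Union>m. G m))"
      using fin by (intro card_mono) auto
    ultimately show False
      using m by auto
  qed
  ultimately show ?thesis
    using G(1) by (intro exI[of _ "\<Union>m. G m"]) auto
qed

theorem theorem4:
  fixes X :: "real set"
  assumes "arbitrarily_relatively_fine X"
  shows "nonuniversal_cofinite_measure X \<and>
    (\<forall>\<epsilon>::real. \<epsilon> > 0 \<longrightarrow>
      (\<exists>G::real set. open G \<and> emeasure lebesgue G < ennreal \<epsilon> \<and>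
        (\<forall>Y. similar_copy Y X \<longrightarrow> infinite (Y \<inter> G)) \<and>
        (\<forall>K. finite K \<longrightarrow> \<not> (\<exists>Y. similar_copy Y (X - K) \<and> Y \<subseteq> - G))))"
proof (intro conjI allI impI)
  obtain G where G: "open G" "emeasure lebesgue G < ennreal 1"
    "\<And>Y. similar_copy Y X \<Longrightarrow> infinite (Y \<inter> G)"
    using ex_open_infinite_Int[OF assms, of 1] by auto
  show "nonuniversal_cofinite_measure X"
    unfolding nonuniversal_cofinite_measure_def
  proof (intro exI[of _ "- G"] conjI notI)
    show "- G \<in> sets lebesgue"
      using G(1) by (intro sets_completionI_sets) (auto simp: closed_Compl)
    show "emeasure lebesgue (- (- G)) < \<infinity>"
      using G(2) by (auto intro: less_trans)
    assume "\<exists>Y. similar_copy Y X \<and> Y \<subseteq> - G"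
    then obtain Y where "infinite (Y \<inter> G)" "Y \<inter> G = {}"
      using G(3) by blast
    then show False
      by simp
  qed
next
  fix \<epsilon> :: real
  assume "0 < \<epsilon>"
  then obtain G where G: "open G" "emeasure lebesgue G < ennreal \<epsilon>"
    "\<And>Y. similar_copy Y X \<Longrightarrow> infinite (Y \<inter> G)"
    using ex_open_infinite_Int[OF assms] by blast
  \<comment> \<open>If the copy of \<open>X - K\<close> avoids \<open>G\<close>, the full copy of
    \<open>X\<close> meets \<open>G\<close> only in images of points of \<open>K\<close>, hence in a
    finite set.\<close>
  have False if "finite K" and Y: "similar_copy Y (X - K)" "Y \<subseteq> - G" for K Y
  proof -
    from Y obtain a b where "b \<noteq> 0" and "(\<lambda>x. a + b * x) ` (X - K) \<subseteq> - G"
      by (auto simp: similar_copy_def)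
    then have "(\<lambda>x. a + b * x) ` X \<inter> G \<subseteq> (\<lambda>x. a + b * x) ` K"
      by blast
    moreover have "infinite ((\<lambda>x. a + b * x) ` X \<inter> G)"
      using G(3) \<open>b \<noteq> 0\<close> by (auto simp: similar_copy_def)
    ultimately show False
      using \<open>finite K\<close> finite_subset by blast
  qed
  with G show "\<exists>G. open G \<and> emeasure lebesgue G < ennreal \<epsilon> \<and>
      (\<forall>Y. similar_copy Y X \<longrightarrow> infinite (Y \<inter> G)) \<and>
      (\<forall>K. finite K \<longrightarrow> \<not> (\<exists>Y. similar_copy Y (X - K) \<and> Y \<subseteq> - G))"
    by blast
qed

end
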